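(* Let $n\ge 1$ and consider the single-peaked domain $\mathcal{SP}([n])$ with its associated Bruhat poset $\mathbb{B}(\mathcal{SP}([n]),1)$. The following (i) and (ii) are exactly the operations on sign representations that traverse the edges of the Bruhat poset: for $\sigma,\tau\in\mathcal{SP}([n])$ with sign representations $s(\sigma),s(\tau)\in\{+,-\}^{n-1}$, there is an edge between $\sigma$ and $\tau$ (i.e. one of them covers the other) in $\mathbb{B}(\mathcal{SP}([n]),1)$ if and only if $s(\tau)$ is obtained from $s(\sigma)$ by one application of one of the operations (i) change the first sign (from $+$ to $-$ or from $-$ to $+$); (ii) swap two opposite neighbouring signs, i.e. replace a pair of consecutive signs $+-$ by $-+$, or a pair of consecutive signs $-+$ by $+-$.
   Context: A preference (linear order) $\sigma$ on $[n]=\{1,\dots,n\}$ is written as a word $i_1 i_2\cdots i_n$, a permutation of $[n]$ listed from the most preferred alternative $i_1$ (the top, or peak) to the least preferred $i_n$. Write $a\succ b$ if $a$ is preferred to $b$, i.e. $a$ occurs before $b$ in the word. The preference with peak $k=i_1$ is single-peaked (with respect to the fixed axis $1<2<\cdots<n$) if for all $k_1,k_2\in[n]$, $k_2<k_1\le k$ or $k_2>k_1\ge k$ implies $k_1\succ k_2$. $\mathcal{SP}([n])$ denotes the set of all single-peaked preferences on $[n]$. Inversions and Bruhat poset: $\mathrm{Inv}(\sigma)$ is the set of pairs $(i,j)$ with $i,j\in[n]$, $i<j$, such that $j$ occurs before $i$ in the word $\sigma$ (so $\mathrm{Inv}(12\cdots n)=\emptyset$). Write $\sigma\ll\tau$ if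 $\mathrm{Inv}(\sigma)\subseteq\mathrm{Inv}(\tau)$. The Bruhat poset $\mathbb{B}(\mathcal{SP}([n]),1)$ is the poset $(\mathcal{SP}([n]),\ll)$. Its edges (arcs of the Bruhat digraph) are drawn from $\sigma$ to $\tau$ when $\tau$ covers $\sigma$, meaning that $\mathrm{Inv}(\sigma)\subset\mathrm{Inv}(\tau)$ and $\mathrm{Inv}(\tau)$ has exactly one more element than $\mathrm{Inv}(\sigma)$. Sign representation: in a single-peaked preference $\sigma=i_1\cdots i_n$ the first $p$ alternatives form an interval of consecutive integers for every $p$, and the next alternative is one of the two neighbours of that interval. For $1\le p\le n-1$ put $s_p=+$ if $i_{p+1}=\max\{i_1,\dots,i_p\}+1$ and $s_p=-$ if $i_{p+1}=\min\{i_1,\dots,i_p\}-1$. The sign representation of $\sigma$ is $s(\sigma)=(s_1,\dots,s_{n-1})$, and it uniquely specifies $\sigma$. For example, with $n=5$, $34251$ has sign representation $+-+-$. *)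

theory Defs
  imports "HOL-Combinatorics.Multiset_Permutations"
begin

text \<open>A preference on \<open>{1..n}\<close> is a list in \<^term>\<open>permutations_of_set {1..n}\<close>, most preferred
  alternative first.\<close>

definition prefers :: "nat list \<Rightarrow> nat \<Rightarrow> nat \<Rightarrow> bool" where
  "prefers w a b \<longleftrightarrow> (\<exists>p q. p < q \<and> q < length w \<and> w ! p = a \<and> w ! q = b)"

definition single_peaked :: "nat \<Rightarrow> nat list \<Rightarrow> bool" where
  "single_peaked n w \<longleftrightarrow>
     (\<forall>k1\<in>{1..n}. \<forall>k2\<in>{1..n}.
        (k2 < k1 \<and> k1 \<le> hd w) \<or> (k2 > k1 \<and> k1 \<ge> hd w) \<longrightarrow> prefers w k1 k2)"

definition SP :: "nat \<Rightarrow> nat list set" where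
  "SP n = {w \<in> permutations_of_set {1..n}. single_peaked n w}"

definition Inv :: "nat list \<Rightarrow> (nat \<times> nat) set" where
  "Inv w = {(i, j). i \<in> set w \<and> j \<in> set w \<and> i < j \<and> prefers w j i}"

definition bruhat_le :: "nat list \<Rightarrow> nat list \<Rightarrow> bool" (infix "\<lless>" 50) where
  "v \<lless> w \<longleftrightarrow> Inv v \<subseteq> Inv w"

definition bruhat_poset :: "nat list set \<Rightarrow> (nat list \<times> nat list) set" where
  "bruhat_poset D = {(v, w). v \<in> D \<and> w \<in> D \<and> v \<lless> w}"

text \<open>Arcs join elements whose inversion sets differ by exactly one pair, so for a general domain
  \<open>D\<close> this relation may be smaller than the order-theoretic covering relation.\<close>

definition bruhat_arcs :: "nat list set \<Rightarrow> (nat list \<times> nat list) set" where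
  "bruhat_arcs D =
     {(v, w) \<in> bruhat_poset D. Inv v \<subset> Inv w \<and> card (Inv w) = card (Inv v) + 1}"

definition bruhat_edge :: "nat list set \<Rightarrow> nat list \<Rightarrow> nat list \<Rightarrow> bool" where
  "bruhat_edge D v w \<longleftrightarrow> (v, w) \<in> bruhat_arcs D \<or> (w, v) \<in> bruhat_arcs D"

datatype sign = SPlus | SMinus

text \<open>Lists are indexed from 0, so \<open>w ! p\<close> is the alternative that follows the first \<open>p\<close> ones.
  On single-peaked preferences the \<open>else\<close> branch means exactly that \<open>w ! p\<close> is the left neighbour
  of the interval formed by the first \<open>p\<close> alternatives; see \<open>step_SMinus_iff\<close> below.\<close>

definition step_sign :: "nat list \<Rightarrow> nat \<Rightarrow> sign" where
  "step_sign w p = (if w ! p = Max (set (take p w)) + 1 then SPlus else SMinus)"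

definition sign_rep :: "nat list \<Rightarrow> sign list" where
  "sign_rep w = map (step_sign w) [1..<length w]"

inductive sign_op :: "sign list \<Rightarrow> sign list \<Rightarrow> bool" where
  change_first: "a \<noteq> b \<Longrightarrow> sign_op (a # xs) (b # xs)"
| swap_neighbours: "a \<noteq> b \<Longrightarrow> sign_op (xs @ [a, b] @ ys) (xs @ [b, a] @ ys)"

lemma step_SPlus_iff: "step_sign w p = SPlus \<longleftrightarrow> w ! p = Max (set (take p w)) + 1"
  by (simp add: step_sign_def)

lemma prefers_nth_imp_in_take:
  assumes "distinct w" "p < length w" "prefers w y (w ! p)"
  shows "y \<in> set (take p w)"
proof -
  obtain a b where ab: "a < b" "b < length w" "w ! a = y" "w ! b = w ! p"
    using assms(3) by (auto simp: prefers_def)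
  then have "b = p" using assms(1,2) by (simp add: nth_eq_iff_index_eq)
  then show ?thesis using ab by (auto simp: in_set_conv_nth intro!: exI[of _ a])
qed

lemma prefers_nth_imp_notin_take:
  assumes "distinct w" "p < length w" "prefers w (w ! p) y"
  shows "y \<notin> set (take p w)"
proof
  assume "y \<in> set (take p w)"
  then obtain c where c: "c < p" "w ! c = y"
    using assms(2) by (auto simp: in_set_conv_nth)
  obtain a b where ab: "a < b" "b < length w" "w ! a = w ! p" "w ! b = y"
    using assms(3) by (auto simp: prefers_def)
  have "a = p" using ab assms(1,2) by (simp add: nth_eq_iff_index_eq)
  moreover have "b = c"
    using nth_eq_iff_index_eq[OF assms(1), of b c] ab c assms(2) by simp
  ultimately show False using ab c by simp
qed

lemma step_SMinus_iff:
  assumes "w \<in> SP n" "1 \<le> p" "p < n"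
  shows "step_sign w p = SMinus \<longleftrightarrow> w ! p + 1 = Min (set (take p w))"
proof -
  have dist: "distinct w" and st: "set w = {1..n}" and sp: "single_peaked n w"
    using assms(1) by (auto simp: SP_def permutations_of_set_def)
  have len: "length w = n" using dist st by (metis card_atLeastAtMost diff_Suc_1 distinct_card)
  define S where "S = set (take p w)"
  define k where "k = hd w"
  define x where "x = w ! p"
  have ne: "w \<noteq> []" using assms len by auto
  have kS: "k \<in> S" unfolding S_def k_def using ne assms by (cases w; cases p) auto
  have finS: "finite S" by (simp add: S_def)
  have SsubS: "S \<subseteq> {1..n}" unfolding S_def st[symmetric] by (rule set_take_subset)
  have xn: "x \<in> {1..n}" unfolding x_def st[symmetric] using assms len by simp
  have before: "y \<in> S" if "prefers w y x" for y
    using prefers_nth_imp_in_take[OF dist] that assms len by (simp add: S_def x_def)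
  have after: "y \<notin> S" if "prefers w x y" for y
    using prefers_nth_imp_notin_take[OF dist] that assms len by (simp add: S_def x_def)
  have xS: "x \<notin> S"
    unfolding S_def x_def using dist assms len by (auto simp: in_set_conv_nth nth_eq_iff_index_eq)
  have kn: "k \<in> {1..n}" using kS SsubS by auto
  have spR: "prefers w k1 k2"
    if "k1 \<in> {1..n}" "k2 \<in> {1..n}" "(k2 < k1 \<and> k1 \<le> k) \<or> (k2 > k1 \<and> k1 \<ge> k)" for k1 k2
    using sp that unfolding single_peaked_def k_def by blast
  have "x \<noteq> k" using xS kS by auto
  then consider "x > k" | "x < k" by linarith
  then show ?thesis
  proof cases
    case 1
    have "x - 1 \<in> S"
      using 1 xn kn by (intro before spR) auto
    moreover have "y \<le> x - 1" if "y \<in> S" for y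
    proof (rule ccontr)
      assume "\<not> y \<le> x - 1"
      then have "y > x" using that xS by (cases "y = x") auto
      then have "prefers w x y"
        using 1 xn that SsubS by (intro spR) auto
      then show False using after that by auto
    qed
    ultimately have "Max S = x - 1" using finS by (intro Max_eqI) auto
    moreover have "Min S \<noteq> x + 1"
    proof -
      have "Min S \<le> k" using kS finS by simp
      then show ?thesis using 1 by linarith
    qed
    ultimately show ?thesis using 1 by (simp add: step_sign_def S_def x_def)
  next
    case 2
    have "x + 1 \<in> S"
      using 2 xn kn by (intro before spR) auto
    moreover have "x + 1 \<le> y" if "y \<in> S" for y
    proof (rule ccontr)
      assume "\<not> x + 1 \<le> y"
      then have "y < x" using that xS by (cases "y = x") auto
      then have "prefers w x y"
        using 2 xn that SsubS by (intro spR) auto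
      then show False using after that by auto
    qed
    ultimately have "Min S = x + 1" using finS by (intro Min_eqI) auto
    moreover have "Max S + 1 \<noteq> x"
    proof -
      have "k \<le> Max S" using kS finS by simp
      then show ?thesis using 2 by linarith
    qed
    ultimately show ?thesis by (simp add: step_sign_def S_def x_def)
  qed
qed

lemma "sign_rep [3, 4, 2, 5, 1] = [SPlus, SMinus, SPlus, SMinus]"
  by (simp add: sign_rep_def step_sign_def upt_rec numeral_nat)

end

theory Submission
  imports Defs
begin

text \<open>
  Appending the \<open>(p+1)\<close>-st alternative to the first \<open>p\<close> ones creates no inversion if its sign is
  \<open>+\<close>, and if its sign is \<open>-\<close> it creates one with each of the \<open>p\<close> preceding alternatives. Hence the
  inversion set of a single-peaked preference is the shifted Young diagram of the strict partition
  formed by the positions of its minus signs. An edge of the Bruhat poset adds one box to this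
  diagram, which means that a minus sign moves one place to the right past a plus sign, or that a
  new part \<open>1\<close> appears, that is, the first sign becomes minus.
\<close>

section \<open>Diagrams of reversed sign lists\<close>

text \<open>Sign lists are read from the last sign to the first, and \<open>c\<close> is the row index at which the
  diagram starts.\<close>

fun sign_inv :: "nat \<Rightarrow> sign list \<Rightarrow> (nat \<times> nat) set" where
  "sign_inv c [] = {}"
| "sign_inv c (SPlus # r) = sign_inv c r"
| "sign_inv c (SMinus # r) = {c} \<times> {c<..c + length r + 1} \<union> sign_inv (Suc c) r"

lemma sign_inv_bounds: "(i, j) \<in> sign_inv c r \<Longrightarrow> c \<le> i \<and> i < j \<and> j \<le> c + length r"
  by (induction c r rule: sign_inv.induct) auto

lemma sign_inv_Suc_notin [simp]: "(c, j) \<notin> sign_inv (Suc c) r"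
  using sign_inv_bounds by fastforce

lemma sign_inv_right_notin [simp]: "length r < k \<Longrightarrow> (i, c + k) \<notin> sign_inv c r"
  using sign_inv_bounds by fastforce

text \<open>Deleting row \<open>c\<close> leaves the lower rows, so an equality of whole diagrams
  passes to the tails of the sign lists.\<close>

lemma sign_inv_Suc_eq: "sign_inv (Suc c) r = sign_inv c (SMinus # r) - {c} \<times> UNIV"
  by auto

text \<open>For nonempty \<open>r\<close>, the box in row \<open>c\<close> and column
  \<open>c + length r\<close> is present exactly when the head of \<open>r\<close> is minus. So the
  diagram determines the head, and deleting the row of a minus head leaves the diagram of the
  tail.\<close>

lemma sign_inv_inj:
  "length r = length r' \<Longrightarrow> sign_inv c r = sign_inv c r' \<Longrightarrow> r = r'"
proof (induction r r' arbitrary: c rule: list_induct2)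
  case (Cons x xs y ys)
  have top: "(c, c + (length xs + 1)) \<in> sign_inv c (z # zs) \<longleftrightarrow> z = SMinus"
    if "length zs = length xs" for z zs
    using that by (cases z) (simp_all del: add_Suc_right)
  have xy: "x = y"
    using top[of xs x] top[of ys y] Cons.hyps Cons.prems by (cases x; cases y) auto
  show ?case
  proof (cases x)
    case SPlus
    then show ?thesis using Cons xy by simp
  next
    case SMinus
    have "sign_inv (Suc c) xs = sign_inv (Suc c) ys"
      using Cons.prems SMinus xy by (simp only: sign_inv_Suc_eq)
    then show ?thesis using Cons.IH xy by blast
  qed
qed simp

section \<open>Box additions and the sign operations\<close>

text \<open>The half of \<open>sign_op\<close> that adds a box, on reversed lists:
  \<open>single\<close> has no tail because a reversed list ends in the first sign, and
  \<open>swap\<close> moves a minus sign to the right in the original order.\<close>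

inductive raise :: "sign list \<Rightarrow> sign list \<Rightarrow> bool" where
  single: "raise [SPlus] [SMinus]"
| swap: "raise (SPlus # SMinus # r) (SMinus # SPlus # r)"
| Cons: "raise r r' \<Longrightarrow> raise (x # r) (x # r')"

inductive_simps raise_Nil [simp]: "raise [] r"

inductive_simps raise_Cons_Cons: "raise (x # r) (y # r')"

lemma raise_Cons_same [simp]: "raise (x # r) (x # r') \<longleftrightarrow> raise r r'"
  by (auto simp: raise_Cons_Cons)

lemma raise_SMinus_SPlus [simp]: "\<not> raise (SMinus # r) (SPlus # r')"
  by (simp add: raise_Cons_Cons)

lemma raise_SPlus_SMinus:
  "raise (SPlus # r) (SMinus # r') \<longleftrightarrow>
     r = [] \<and> r' = [] \<or> (\<exists>t. r = SMinus # t \<and> r' = SPlus # t)"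
  by (auto simp: raise_Cons_Cons)

lemma raise_append: "raise r r' \<Longrightarrow> raise (zs @ r) (zs @ r')"
  by (induction zs) auto

lemma sign_op_sym: "sign_op s t \<Longrightarrow> sign_op t s"
  by (induction rule: sign_op.induct) (metis sign_op.intros)+

lemma sign_op_snoc: "sign_op s t \<Longrightarrow> sign_op (s @ [x]) (t @ [x])"
proof (induction rule: sign_op.induct)
  case (change_first a b xs)
  then show ?case using sign_op.change_first[of a b "xs @ [x]"] by simp
next
  case (swap_neighbours a b xs ys)
  then show ?case using sign_op.swap_neighbours[of a b xs "ys @ [x]"] by simp
qed

lemma raise_imp_sign_op: "raise r r' \<Longrightarrow> sign_op (rev r) (rev r')"
proof (induction rule: raise.induct)
  case single
  then show ?case using sign_op.change_first[of SPlus SMinus "[]"] by simp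
next
  case (swap r)
  then show ?case using sign_op.swap_neighbours[of SMinus SPlus "rev r" "[]"] by simp
next
  case (Cons r r' x)
  then show ?case by (simp add: sign_op_snoc)
qed

text \<open>\<open>sign_op\<close> is symmetric, and each application is a \<open>raise\<close> in
  one direction or the other, depending on which of the signs involved is minus.\<close>

lemma sign_op_iff_raise:
  "sign_op s t \<longleftrightarrow> raise (rev s) (rev t) \<or> raise (rev t) (rev s)"
proof
  assume "sign_op s t"
  then show "raise (rev s) (rev t) \<or> raise (rev t) (rev s)"
  proof (induction rule: sign_op.induct)
    case (change_first a b xs)
    then show ?case
      using raise_append[OF raise.single, of "rev xs"] by (cases a; cases b) auto
  next
    case (swap_neighbours a b xs ys)
    then show ?case
      using raise_append[OF raise.swap[of "rev xs"], of "rev ys"] by (cases a; cases b) auto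
  qed
next
  assume "raise (rev s) (rev t) \<or> raise (rev t) (rev s)"
  then show "sign_op s t"
    using raise_imp_sign_op[of "rev s" "rev t"] raise_imp_sign_op[of "rev t" "rev s"]
    by (auto intro: sign_op_sym)
qed

text \<open>Equal heads contribute the same boxes, which cancel. A head going from minus to plus
  loses a box. A head going from plus to minus gains the last box of row \<open>c\<close>, and
  allowing no further change fixes the next sign and the tail.\<close>

lemma sign_inv_insert_iff_raise:
  "length r = length r' \<Longrightarrow>
     (\<exists>b. b \<notin> sign_inv c r \<and> sign_inv c r' = insert b (sign_inv c r)) \<longleftrightarrow> raise r r'"
proof (induction r r' arbitrary: c rule: list_induct2)
  case (Cons x xs y ys)
  let ?L = "length xs"
  let ?A = "sign_inv c (x # xs)" and ?B = "sign_inv c (y # ys)"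
  let ?row = "{c} \<times> {c<..c + ?L + 1}"
  show ?case
  proof (cases x; cases y)
    assume "x = SPlus" "y = SPlus"
    then show ?thesis using Cons.IH[of c] by (simp only: sign_inv.simps raise_Cons_same)
  next
    assume xy: "x = SMinus" "y = SMinus"
    have disj: "?row \<inter> sign_inv (Suc c) zs = {}" for zs
      by auto
    have "(\<exists>b. b \<notin> ?row \<union> A \<and> ?row \<union> B = insert b (?row \<union> A)) \<longleftrightarrow>
        (\<exists>b. b \<notin> A \<and> B = insert b A)"
      if "?row \<inter> A = {}" "?row \<inter> B = {}" for A B
      using that by blast
    from this[OF disj disj] show ?thesis
      using xy Cons.IH[of "Suc c"] Cons.hyps by simp
  next
    assume xy: "x = SMinus" "y = SPlus"
    have "(c, c + (?L + 1)) \<in> ?A" "(c, c + (?L + 1)) \<notin> ?B"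
      using xy Cons.hyps sign_inv_right_notin[of ys "?L + 1" c c] by auto
    then show ?thesis unfolding xy by (metis insertI2 raise_SMinus_SPlus)
  next
    assume xy: "x = SPlus" "y = SMinus"
    let ?e = "(c, c + (?L + 1))"
    have e: "?e \<in> ?B" "?e \<notin> ?A"
      using xy Cons.hyps sign_inv_right_notin[of xs "?L + 1" c c] by auto
    have "raise (x # xs) (y # ys)" if "?B = insert ?e ?A"
    proof (cases xs)
      case Nil
      then show ?thesis using xy Cons.hyps by (simp add: raise_SPlus_SMinus)
    next
      case (Cons z t)
      then obtain z' t' where ys: "ys = z' # t'" and len: "length t' = length t"
        using \<open>length xs = length ys\<close> by (cases ys) auto
      \<comment> \<open>The box to the left of the new one must already lie in \<open>?A\<close>,
        whose row \<open>c\<close> reaches that far only if \<open>z\<close> is minus.\<close>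
      have "(c, c + ?L) \<in> ?B"
        using xy \<open>length xs = length ys\<close> Cons by auto
      then have "(c, c + ?L) \<in> ?A"
        using that by auto
      then have z: "z = SMinus"
        using xy Cons sign_inv_right_notin[of t ?L c c] by (cases z) auto
      \<comment> \<open>Outside row \<open>c\<close> nothing changes, so \<open>ys\<close> and
        \<open>t\<close> give the same lower rows.\<close>
      have "?B - {c} \<times> UNIV = ?A - {c} \<times> UNIV"
        using that by simp
      then have eq: "sign_inv (Suc c) ys = sign_inv (Suc c) t"
        using xy z Cons by (simp only: sign_inv_Suc_eq sign_inv.simps(2))
      \<comment> \<open>Being one sign shorter than \<open>ys\<close>, \<open>t\<close> cannot reach
        column \<open>Suc c + ?L\<close>, whereas a minus \<open>z'\<close> would put a box
        there.\<close>
      have "(Suc c, Suc c + ?L) \<notin> sign_inv (Suc c) t"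
        using Cons by (intro sign_inv_right_notin) simp
      moreover have "(Suc c, Suc c + ?L) \<in> sign_inv (Suc c) ys" if "z' = SMinus"
        using that by (simp add: ys len Cons)
      ultimately have z': "z' = SPlus"
        unfolding eq by (cases z') simp_all
      have "sign_inv (Suc c) t' = sign_inv (Suc c) t"
        using eq unfolding ys z' by simp
      then have "t' = t"
        by (rule sign_inv_inj[OF len])
      then show ?thesis
        using xy z z' ys Cons by (simp add: raise_SPlus_SMinus)
    qed
    moreover have "?B = insert ?e ?A" if "raise (x # xs) (y # ys)"
      using that xy by (auto simp: raise_SPlus_SMinus)
    \<comment> \<open>Since \<open>?e\<close> lies in \<open>?B\<close> but not in
      \<open>?A\<close>, it is the only candidate for the added element.\<close>
    ultimately show ?thesis using e by (metis insertE)
  qed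
qed simp

section \<open>Inversion sets of single-peaked preferences\<close>

lemma prefers_snoc: "prefers (u @ [x]) a b \<longleftrightarrow> prefers u a b \<or> b = x \<and> a \<in> set u"
proof
  assume "prefers (u @ [x]) a b"
  then obtain p q where pq: "p < q" "q < Suc (length u)" "(u @ [x]) ! p = a" "(u @ [x]) ! q = b"
    by (auto simp: prefers_def)
  show "prefers u a b \<or> b = x \<and> a \<in> set u"
  proof (cases "q = length u")
    case True
    then show ?thesis using pq by (auto simp: nth_append)
  next
    case False
    then have "p < q" "q < length u" "u ! p = a" "u ! q = b"
      using pq by (auto simp: nth_append)
    then show ?thesis unfolding prefers_def by blast
  qed
next
  assume "prefers u a b \<or> b = x \<and> a \<in> set u"
  then show "prefers (u @ [x]) a b"
  proof
    assume "prefers u a b"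
    then obtain p q where "p < q" "q < length u" "u ! p = a" "u ! q = b"
      unfolding prefers_def by blast
    then show ?thesis
      unfolding prefers_def by (intro exI[of _ p] exI[of _ q]) (simp add: nth_append)
  next
    assume "b = x \<and> a \<in> set u"
    then obtain p where "p < length u" "u ! p = a" "b = x"
      by (auto simp: in_set_conv_nth)
    then show ?thesis
      unfolding prefers_def by (intro exI[of _ p] exI[of _ "length u"]) (simp add: nth_append)
  qed
qed

lemma prefers_imp_in_set: "prefers u a b \<Longrightarrow> a \<in> set u \<and> b \<in> set u"
  by (auto simp: prefers_def)

text \<open>The last alternative can only be the smaller member of a new inversion.\<close>

lemma Inv_snoc: "Inv (u @ [x]) = Inv u \<union> {x} \<times> {j \<in> set u. x < j}"
  unfolding Inv_def using prefers_imp_in_set by (auto simp: prefers_snoc)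

lemma Inv_singleton: "Inv [x] = {}"
  by (auto simp: Inv_def)

lemma length_SP: "w \<in> SP n \<Longrightarrow> length w = n"
  using length_finite_permutations_of_set[of w "{1..n}"] by (simp add: SP_def)

text \<open>The row index \<open>a\<close> is the least element of the prefix: it stays under a plus
  and drops by one under a minus, where the new row spans the former interval.\<close>

lemma Inv_take:
  assumes w: "w \<in> SP n" and p: "1 \<le> p" "p \<le> n"
  shows "\<exists>a. set (take p w) = {a..<a + p} \<and>
     Inv (take p w) = sign_inv a (rev (map (step_sign w) [1..<p]))"
  using p
proof (induction p rule: dec_induct)
  case base
  then obtain x v where "w = x # v"
    using length_SP[OF w] by (cases w) auto
  then show ?case by (auto simp: Inv_singleton)
next
  case (step p)
  then obtain a where a: "set (take p w) = {a..<a + p}"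
    and inv: "Inv (take p w) = sign_inv a (rev (map (step_sign w) [1..<p]))"
    by auto
  have tk: "take (Suc p) w = take p w @ [w ! p]"
    using step length_SP[OF w] by (simp add: take_Suc_conv_app_nth)
  have maxmin: "Max {a..<a + p} = a + p - 1" "Min {a..<a + p} = a"
    using step by (auto intro!: Max_eqI Min_eqI)
  show ?case
  proof (cases "step_sign w p")
    case SPlus
    then have "w ! p = a + p"
      using a maxmin step by (simp add: step_SPlus_iff)
    then show ?thesis
      using a inv SPlus step by (intro exI[of _ a]) (auto simp: tk Inv_snoc)
  next
    case SMinus
    then have x: "w ! p + 1 = a"
      using step_SMinus_iff[OF w, of p] a maxmin step by simp
    \<comment> \<open>The list \<open>[1..<p]\<close> has \<open>p - 1\<close> entries, so the right
      end is \<open>w ! p + p = a + p - 1\<close>, the largest earlier alternative.\<close>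
    then have "{j \<in> {a..<a + p}. w ! p < j} = {w ! p<..w ! p + length [1..<p] + 1}"
      using step by auto
    then have "Inv (take (Suc p) w) = sign_inv (w ! p) (rev (map (step_sign w) [1..<Suc p]))"
      using a inv SMinus step x by (simp add: tk Inv_snoc Un_commute)
    moreover have "set (take (Suc p) w) = {w ! p..<w ! p + Suc p}"
      using a x by (auto simp: tk)
    ultimately show ?thesis by blast
  qed
qed

lemma Inv_eq_sign_inv:
  assumes "n \<ge> 1" "w \<in> SP n"
  shows "Inv w = sign_inv 1 (rev (sign_rep w))"
proof -
  obtain a where "set w = {a..<a + n}" "Inv w = sign_inv a (rev (sign_rep w))"
    using Inv_take[OF assms(2,1) order_refl] length_SP[OF assms(2)] unfolding sign_rep_def by auto
  moreover have "set w = {1..<1 + n}"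
    using permutations_of_setD(1)[of w "{1..n}"] assms(2)
    by (simp add: SP_def atLeastLessThanSuc_atLeastAtMost)
  \<comment> \<open>A nonempty interval determines its left end, so \<open>a = 1\<close>.\<close>
  ultimately show ?thesis
    using assms(1) atLeastLessThan_inj(1)[of a "a + n" 1 "1 + n"] by simp
qed

section \<open>Arcs of the Bruhat poset as box additions\<close>

lemma psubset_card_Suc_iff_insert:
  assumes "finite B"
  shows "A \<subset> B \<and> card B = card A + 1 \<longleftrightarrow> (\<exists>b. b \<notin> A \<and> B = insert b A)"
proof
  assume AB: "A \<subset> B \<and> card B = card A + 1"
  then have "card (B - A) = 1"
    using assms by (subst card_Diff_subset) (auto intro: finite_subset)
  then obtain b where "B - A = {b}"
    by (auto simp: card_1_singleton_iff)
  then show "\<exists>b. b \<notin> A \<and> B = insert b A"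
    using AB by blast
next
  assume "\<exists>b. b \<notin> A \<and> B = insert b A"
  then show "A \<subset> B \<and> card B = card A + 1"
    using assms by auto
qed

lemma bruhat_arcs_SP_iff:
  assumes "n \<ge> 1" "v \<in> SP n" "w \<in> SP n"
  shows "(v, w) \<in> bruhat_arcs (SP n) \<longleftrightarrow> raise (rev (sign_rep v)) (rev (sign_rep w))"
proof -
  have "finite (Inv w)"
    by (rule finite_subset[of _ "set w \<times> set w"]) (auto simp: Inv_def)
  then have "(v, w) \<in> bruhat_arcs (SP n) \<longleftrightarrow> (\<exists>b. b \<notin> Inv v \<and> Inv w = insert b (Inv v))"
    using assms psubset_card_Suc_iff_insert[of "Inv w" "Inv v"]
    by (auto simp: bruhat_arcs_def bruhat_poset_def bruhat_le_def)
  then show ?thesis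
    using assms sign_inv_insert_iff_raise[of "rev (sign_rep v)" "rev (sign_rep w)" 1]
    by (simp add: Inv_eq_sign_inv sign_rep_def length_SP)
qed

theorem theorem3:
  fixes n :: nat and \<sigma> \<tau> :: "nat list"
  assumes "n \<ge> 1" and "\<sigma> \<in> SP n" and "\<tau> \<in> SP n"
  shows "bruhat_edge (SP n) \<sigma> \<tau> \<longleftrightarrow> sign_op (sign_rep \<sigma>) (sign_rep \<tau>)"
  using assms by (simp add: bruhat_edge_def bruhat_arcs_SP_iff sign_op_iff_raise)

end
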